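(* Let $\mathbb{F}$ be a field, let $V$ be an infinite-dimensional vector space over $\mathbb{F}$, and let $p_1,p_2,p_3$ be split non-derogatory polynomials of $\mathbb{F}[t]$ with degree $2$. Let $u$ be an automorphism of $V$ with no dominant eigenvalue. Then $u$ is a $(p_1,p_2,p_3)$-product in $\mathrm{End}(V)$.
   Context: A polynomial $p\in\mathbb{F}[t]$ is called non-derogatory if $p(0)\neq 0$. For non-derogatory polynomials $p_1,\dots,p_n$, an element $x$ of a (unital associative) $\mathbb{F}$-algebra $\mathcal{A}$ is called a $(p_1,\dots,p_n)$-product if $x=a_1\cdots a_n$ for some $a_1,\dots,a_n\in\mathcal{A}$ with $p_i(a_i)=0$ for all $i$. For $u\in\mathrm{End}(V)$, a scalar $\lambda\in\mathbb{F}$ is called a dominant eigenvalue of $u$ if $\mathrm{rk}(u-\lambda\,\mathrm{id}_V)<\dim V$ (inequality of cardinals). *)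

theory Defs
  imports "HOL-Computational_Algebra.Polynomial"
begin

definition nonderogatory :: "'a::field poly \<Rightarrow> bool"
  where "nonderogatory p \<longleftrightarrow> poly p 0 \<noteq> 0"

definition split_poly :: "'a::field poly \<Rightarrow> bool"
  where "split_poly p \<longleftrightarrow> (\<exists>c as. c \<noteq> 0 \<and> p = smult c (\<Prod>a\<leftarrow>as. [:- a, 1:]))"

(* Below, scale is the scalar multiplication of a vector space in the sense of the locale
   vector_space. It is an explicit argument, because definitions made inside that locale
   would also be instantiated for (and shadowed by) the real vector spaces. *)

(* The dimension of a subspace as a cardinal in the sense of HOL.BNF_Cardinal_Order_Relation
   (the library's dim is a natural number, hence useless for infinite-dimensional spaces).
   The lemma after it shows that the choice of basis is immaterial. *)
definition cdim :: "('a::field \<Rightarrow> 'b::ab_group_add \<Rightarrow> 'b) \<Rightarrow> 'b set \<Rightarrow> 'b rel"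
  where "cdim scale S =
    card_of (SOME B. \<not> module.dependent scale B \<and> module.span scale B = S)"

lemma cdim_ordIso:
  assumes "vector_space scale" "\<not> module.dependent scale B" "module.span scale B = S"
  shows "ordIso2 (cdim scale S) (card_of B)"
proof -
  let ?P = "\<lambda>B. \<not> module.dependent scale B \<and> module.span scale B = S"
  have P: "?P (SOME B. ?P B)"
    using assms by (intro someI[of ?P B]) simp
  then obtain f where "bij_betw f (SOME B. ?P B) B"
    using vector_space.bij_if_span_eq_span_bases[OF assms(1), of "SOME B. ?P B" B] assms by auto
  then show ?thesis
    unfolding cdim_def by (rule card_of_ordIsoI)
qed

definition crank :: "('a::field \<Rightarrow> 'b::ab_group_add \<Rightarrow> 'b) \<Rightarrow> ('b \<Rightarrow> 'b) \<Rightarrow> 'b rel"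
  where "crank scale f = cdim scale (range f)"

definition dominant_eigenvalue ::
    "('a::field \<Rightarrow> 'b::ab_group_add \<Rightarrow> 'b) \<Rightarrow> ('b \<Rightarrow> 'b) \<Rightarrow> 'a \<Rightarrow> bool"
  where "dominant_eigenvalue scale u c \<longleftrightarrow>
    ordLess2 (crank scale (\<lambda>x. u x - scale c x)) (cdim scale UNIV)"

(* Evaluation of p at f in the algebra of endomorphisms, whose multiplication is composition. *)
definition poly_endo ::
    "('a::field \<Rightarrow> 'b::ab_group_add \<Rightarrow> 'b) \<Rightarrow> 'a poly \<Rightarrow> ('b \<Rightarrow> 'b) \<Rightarrow> 'b \<Rightarrow> 'b"
  where "poly_endo scale p f = (\<lambda>x. \<Sum>i\<le>degree p. scale (coeff p i) ((f ^^ i) x))"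

(* x is a (p_1, ..., p_n)-product in End(V), where ps is the list of the p_i. *)
definition poly_product ::
    "('a::field \<Rightarrow> 'b::ab_group_add \<Rightarrow> 'b) \<Rightarrow> 'a poly list \<Rightarrow> ('b \<Rightarrow> 'b) \<Rightarrow> bool"
  where "poly_product scale ps x \<longleftrightarrow>
    (\<exists>as. list_all2 (\<lambda>p a. Vector_Spaces.linear scale scale a \<and> poly_endo scale p a = (\<lambda>_. 0)) ps as
      \<and> x = foldr (\<circ>) as id)"

end

theory Submission
  imports Defs "HOL-Library.Product_Plus"
begin

text \<open>
  After scaling, \<open>p\<^sub>1\<close> has the roots \<open>1\<close> and \<open>1 / \<beta>\<close>. Let \<open>H\<close> be maximal such that \<open>H\<close> and \<open>u H\<close> are disjoint and
  jointly independent; if \<open>|H| < dim V\<close>, then \<open>u\<close> would be scalar modulo the span of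
  \<open>H \<union> u H\<close>, and so have a dominant eigenvalue. Complete \<open>H \<union> u H\<close> to a basis \<open>B \<union> u H\<close> with
  \<open>H \<subseteq> B\<close>, let \<open>P\<close> be the projection onto the span of \<open>B\<close> along \<open>K = span (u H)\<close>, and let
  \<open>c b = u b\<close> for \<open>b \<in> H\<close>, \<open>c b = b\<close> for \<open>b \<in> B - H\<close>. Whatever injection \<open>\<sigma>\<close> from \<open>B\<close> to \<open>H\<close> is
  chosen, the map \<open>w\<close> with \<open>w h = u h\<close> on \<open>H\<close> and
  \<open>w (c b) = \<beta> P (u (c b)) + u (\<sigma> b)\<close> on the rest of the basis satisfies \<open>u = f w\<close>,
  where \<open>f\<close> is the identity on \<open>K\<close> and \<open>1 / \<beta>\<close> modulo \<open>K\<close>, hence quadratic.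

  Since \<open>|H| = |B|\<close>, one can choose \<open>\<sigma> b\<close> larger, in a well-order of \<open>B\<close>, than \<open>b\<close> and all the
  basis vectors in the support of \<open>P (u (c b))\<close>. Then the defining relations of \<open>w\<close> express every
  \<open>\<sigma> b\<close> through smaller basis vectors, so that \<open>V\<close> is a free module over the Laurent polynomials
  in \<open>w\<close>. With \<open>s = w + d w\<^sup>-\<^sup>1\<close>, \<open>d\<close> being the product of the roots of \<open>p\<^sub>2\<close> and \<open>p\<^sub>3\<close>, the space is
  \<open>W \<oplus> w W\<close> for an \<open>s\<close>-stable subspace \<open>W\<close>. On such a sum \<open>w\<close> acts as a two by two matrix with
  entries polynomial in \<open>s\<close> and determinant \<open>d\<close>, which is a product of two such matrices
  whose characteristic polynomials are \<open>p\<^sub>2\<close> and \<open>p\<^sub>3\<close> up to scalars.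
\<close>

unbundle cardinal_syntax

section \<open>Injective choices that climb in a well-order\<close>

lemma finite_less_infinite: "finite A \<Longrightarrow> infinite B \<Longrightarrow> |A| <o |B|"
  by (rule finite_ordLess_infinite) (simp_all add: Field_card_of card_of_well_order_on)

text \<open>A finite set generates an initial segment of the cardinal well-order with fewer than
  \<open>|B|\<close> elements, whereas each piece of \<open>H\<close> has \<open>|B|\<close>
  elements and so contains one beyond that segment.\<close>

lemma inj_choice_above_finite:
  assumes inf: "infinite B" and le: "|B| \<le>o |H|" and HB: "H \<subseteq> B"
    and S: "\<And>b. b \<in> B \<Longrightarrow> finite (S b) \<and> S b \<subseteq> B"
  obtains \<sigma> :: "'a \<Rightarrow> 'a" and R where "wf R" "inj_on \<sigma> B" "\<sigma> ` B \<subseteq> H"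
    "\<And>b s. b \<in> B \<Longrightarrow> s \<in> S b \<Longrightarrow> (s, \<sigma> b) \<in> R"
proof -
  let ?r = "|B|"
  have wo: "well_order_on B ?r" by (rule card_of_well_order_on)
  txt \<open>Splitting \<open>H\<close> into \<open>B\<close>-many pieces of full cardinality makes any choice from the pieces injective.\<close>
  have "|B \<times> B| \<le>o |H|"
    using card_of_Times_same_infinite[OF inf] le ordIso_ordLeq_trans by blast
  then obtain \<beta> where \<beta>: "inj_on \<beta> (B \<times> B)" "\<beta> ` (B \<times> B) \<subseteq> H"
    using card_of_ordLeq[of "B \<times> B" H] by auto
  have under: "|under ?r s| <o |B|" if "s \<in> B" for s
  proof -
    have "|underS ?r s| <o ?r"
      by (rule card_of_underS[OF card_of_Card_order]) (simp add: that Field_card_of)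
    moreover have "|{s}| <o |B|"
      using inf by (simp add: finite_less_infinite)
    ultimately have "|underS ?r s \<union> {s}| <o |B|"
      by (rule card_of_Un_ordLess_infinite[OF inf])
    moreover have "under ?r s \<subseteq> underS ?r s \<union> {s}"
      by (auto simp: under_def underS_def)
    ultimately show ?thesis
      using card_of_mono1 ordLeq_ordLess_trans by blast
  qed
  have Under: "|\<Union>s\<in>F. under ?r s| <o |B|" if "finite F" "F \<subseteq> B" for F
    using that
  proof (induction F rule: finite_induct)
    case empty
    have "|{}::'a set| <o |B|"
      using inf by (simp add: finite_less_infinite)
    then show ?case by simp
  next
    case (insert s F)
    then show ?case
      using card_of_Un_ordLess_infinite[OF inf under[of s], of "\<Union>s\<in>F. under ?r s"] by simp
  qed
  have "\<exists>c\<in>B. \<forall>s\<in>S b. \<beta> (b, c) \<notin> under ?r s" if b: "b \<in> B" for b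
  proof (rule ccontr)
    assume "\<not> ?thesis"
    then have "(\<lambda>c. \<beta> (b, c)) ` B \<subseteq> (\<Union>s\<in>S b. under ?r s)"
      by blast
    moreover have "inj_on (\<lambda>c. \<beta> (b, c)) B"
      using \<beta>(1) b by (auto simp: inj_on_def)
    ultimately have "|B| \<le>o |\<Union>s\<in>S b. under ?r s|"
      using card_of_ordLeq by blast
    then show False
      using Under[of "S b"] S[OF b] not_ordLess_ordLeq by blast
  qed
  then obtain c where c: "\<And>b. b \<in> B \<Longrightarrow> c b \<in> B"
      "\<And>b s. b \<in> B \<Longrightarrow> s \<in> S b \<Longrightarrow> \<beta> (b, c b) \<notin> under ?r s"
    by metis
  define \<sigma> where "\<sigma> b = \<beta> (b, c b)" for b
  show thesis
  proof (rule that[of "?r - Id" \<sigma>])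
    show "wf (?r - Id)"
      using wo by (simp add: well_order_on_def)
    show "inj_on \<sigma> B"
    proof (rule inj_onI)
      fix x y assume "x \<in> B" "y \<in> B" "\<sigma> x = \<sigma> y"
      then show "x = y"
        using inj_onD[OF \<beta>(1), of "(x, c x)" "(y, c y)"] c(1) by (simp add: \<sigma>_def)
    qed
    show "\<sigma> ` B \<subseteq> H"
      using \<beta>(2) c(1) by (auto simp: \<sigma>_def)
    fix b s assume b: "b \<in> B" "s \<in> S b"
    then have s: "s \<in> B" and \<sigma>: "\<sigma> b \<in> B"
      using S[of b] \<beta>(2) c(1)[of b] HB by (auto simp: \<sigma>_def)
    have n: "(\<sigma> b, s) \<notin> ?r"
      using c(2)[OF b] by (simp add: under_def \<sigma>_def)
    have tot: "total_on B ?r" and refl: "refl_on B ?r"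
      using wo by (auto simp: well_order_on_def linear_order_on_def partial_order_on_def preorder_on_def)
    have "s \<noteq> \<sigma> b" using n refl s by (auto simp: refl_on_def)
    then show "(s, \<sigma> b) \<in> ?r - Id"
      using tot n s \<sigma> by (auto simp: total_on_def)
  qed
qed

section \<open>Quadratic endomorphisms and products of two of them\<close>

locale vspace = vector_space scale
  for scale :: "'a::field \<Rightarrow> 'b::ab_group_add \<Rightarrow> 'b"
begin

sublocale vv: vector_space_pair scale scale ..

abbreviation lin :: "('b \<Rightarrow> 'b) \<Rightarrow> bool"
  where "lin \<equiv> Vector_Spaces.linear scale scale"

text \<open>The polynomial \<open>(t - a) (t - b)\<close> annihilates \<open>f\<close>.\<close>

definition quadratic :: "'a \<Rightarrow> 'a \<Rightarrow> ('b \<Rightarrow> 'b) \<Rightarrow> bool"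
  where "quadratic a b f \<longleftrightarrow> lin f \<and> (\<forall>x. f (f x) = scale (a + b) (f x) - scale (a * b) x)"

lemma linI:
  assumes "\<And>x y. f (x + y) = f x + f y" "\<And>c x. f (scale c x) = scale c (f x)"
  shows "lin f"
  using assms by (simp add: Vector_Spaces.linear_iff vector_space_axioms)

lemma lin_eqI:
  assumes "lin f" "lin g" "span B = UNIV" "\<And>b. b \<in> B \<Longrightarrow> f b = g b"
  shows "f x = g x"
  using vv.linear_eq_on[OF assms(1,2), of x B] assms(3,4) by simp

lemma quadraticI:
  assumes f: "lin f" and B: "span B = UNIV"
    and eq: "\<And>x. x \<in> B \<Longrightarrow> f (f x) = scale (a + b) (f x) - scale (a * b) x"
  shows "quadratic a b f"
proof -
  interpret f: Vector_Spaces.linear scale scale f by fact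
  have "f (f x) = scale (a + b) (f x) - scale (a * b) x" for x
    by (rule lin_eqI[of "\<lambda>x. f (f x)" "\<lambda>x. scale (a + b) (f x) - scale (a * b) x" B x])
      (auto intro!: linI simp: f.add f.scale B eq algebra_simps)
  then show ?thesis using f by (simp add: quadratic_def)
qed

lemma quadratic_scale:
  assumes "quadratic 1 b f"
  shows "quadratic c (c * b) (\<lambda>x. scale c (f x))"
proof -
  interpret f: Vector_Spaces.linear scale scale f using assms by (simp add: quadratic_def)
  have eq: "f (f x) = scale (1 + b) (f x) - scale b x" for x
    using assms by (simp add: quadratic_def)
  have "scale c (f (scale c (f x))) =
      scale (c + c * b) (scale c (f x)) - scale (c * (c * b)) x" for x
    by (simp add: f.scale eq) (simp add: algebra_simps)
  moreover have "lin (\<lambda>x. scale c (f x))"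
    by (rule linI) (simp_all add: f.scale f.add scale_right_distrib mult.commute)
  ultimately show ?thesis
    by (simp add: quadratic_def)
qed

text \<open>Replaces polynomials by pairs of roots, which are nonzero because p(0) is.\<close>

lemma poly_endo_quadratic:
  assumes "split_poly p" "nonderogatory p" "degree p = 2"
  obtains a b where "a \<noteq> 0" "b \<noteq> 0" "\<And>f. quadratic a b f \<Longrightarrow> poly_endo scale p f = (\<lambda>_. 0)"
proof -
  obtain c as where c: "c \<noteq> 0" and p: "p = smult c (\<Prod>a\<leftarrow>as. [:- a, 1:])"
    using assms(1) by (auto simp: split_poly_def)
  have "degree (\<Prod>a\<leftarrow>as. [:- a, 1:]) = length as" for as :: "'a list"
  proof (induction as)
    case (Cons a as)
    have "(\<Prod>a\<leftarrow>as. [:- a, 1:]) \<noteq> 0"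
      by (auto simp: prod_list_zero_iff)
    then show ?case using Cons by (simp add: degree_mult_eq del: mult_pCons_left)
  qed simp
  then have "length as = 2" using assms(3) c p by simp
  then obtain a b where as: "as = [a, b]"
    by (auto simp: numeral_2_eq_2 length_Suc_conv)
  have p: "p = [:c * (a * b), - (c * (a + b)), c:]"
    by (simp add: p as algebra_simps)
  show thesis
  proof
    show "a \<noteq> 0" "b \<noteq> 0" using assms(2) by (auto simp: p nonderogatory_def)
    fix f assume f: "quadratic a b f"
    have "poly_endo scale p f x = 0" for x
    proof -
      have "poly_endo scale p f x =
        scale (c * (a * b)) x + scale (- (c * (a + b))) (f x) + scale c (f (f x))"
        unfolding poly_endo_def assms(3) by (simp add: p numeral_2_eq_2)
      also have "f (f x) = scale (a + b) (f x) - scale (a * b) x"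
        using f by (simp add: quadratic_def)
      finally show ?thesis by (simp add: algebra_simps)
    qed
    then show "poly_endo scale p f = (\<lambda>_. 0)" by auto
  qed
qed

text \<open>Relative to \<open>span E\<close> and its image under \<open>w\<close>, the matrix of
  \<open>w\<close> has columns (0, 1) and (-d, z) with d = a b a' b'. It is the product of
  \<open>f\<close> with columns (0, 1/a') and (-a b a', a + b), of trace a + b and determinant a b,
  and \<open>g\<close> with columns (a', 0) and (y, b').\<close>

lemma ex_two_quadratic_factors:
  assumes w: "lin w" and E: "independent (E \<union> w ` E)" "E \<inter> w ` E = {}" "inj_on w E"
      "span (E \<union> w ` E) = UNIV"
    and z: "\<And>e. e \<in> E \<Longrightarrow> z e \<in> span E"
      "\<And>e. e \<in> E \<Longrightarrow> w (w e) = w (z e) - scale (a * b * (a' * b')) e"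
    and a': "a' \<noteq> 0"
  obtains f g where "quadratic a b f" "quadratic a' b' g" "w = f \<circ> g"
proof -
  interpret w: Vector_Spaces.linear scale scale w by fact
  define v where "v = the_inv_into E w"
  have v: "v (w e) = e" if "e \<in> E" for e
    using that E(3) by (simp add: v_def the_inv_into_f_f)
  \<comment> \<open>The off-diagonal entry of \<open>g\<close>, solved from
    \<open>f (g (w e)) = w (w e)\<close>.\<close>
  define y where "y e = scale a' (z e - scale (b' * (a + b)) e)" for e
  define g where "g = vv.construct (E \<union> w ` E)
    (\<lambda>e. if e \<in> E then scale a' e else scale b' e + y (v e))"
  define f where "f = vv.construct (E \<union> w ` E)
    (\<lambda>e. if e \<in> E then scale (1 / a') (w e) else scale (a + b) e - scale (a * b * a') (v e))"
  have lg: "lin g" and lf: "lin f"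
    unfolding f_def g_def by (rule vv.linear_construct[OF E(1)])+
  interpret f: Vector_Spaces.linear scale scale f by fact
  interpret g: Vector_Spaces.linear scale scale g by fact
  have ff: "f e = scale (1 / a') (w e)" "f (w e) = scale (a + b) (w e) - scale (a * b * a') e"
    and gg: "g e = scale a' e" "g (w e) = scale b' (w e) + y e" if "e \<in> E" for e
    using that E(2) v[OF that] by (auto simp: f_def g_def vv.construct_basis[OF E(1)])
  have sf: "f x = scale (1 / a') (w x)" if "x \<in> span E" for x
    by (rule vv.linear_eq_on[OF lf _ that])
      (auto intro!: linI simp: w.add w.scale algebra_simps ff)
  have sg: "g x = scale a' x" if "x \<in> span E" for x
    by (rule vv.linear_eq_on[OF lg _ that])
      (auto intro!: linI simp: algebra_simps gg)
  have yE: "y e \<in> span E" if "e \<in> E" for e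
    unfolding y_def using that z(1) by (intro span_scale span_diff) (auto intro: span_base)
  show thesis
  proof
    show "quadratic a b f"
      by (rule quadraticI[OF lf E(4)]) (auto simp: ff f.scale f.diff f.add a' algebra_simps)
    show "quadratic a' b' g"
      by (rule quadraticI[OF lg E(4)])
        (auto simp: gg sg[OF yE] g.scale g.diff g.add algebra_simps)
    have "w x = f (g x)" for x
    proof (rule lin_eqI[OF w _ E(4)])
      show "lin (\<lambda>x. f (g x))"
        by (rule linI) (auto simp: f.add f.scale g.add g.scale)
      have "f (g (w e)) = w (w e)" if e: "e \<in> E" for e
      proof -
        have "f (y e) = w (z e) - scale (b' * (a + b)) (w e)"
          using a' by (subst sf[OF yE[OF e]]) (simp add: y_def w.scale w.diff)
        then show ?thesis
          by (simp add: e gg ff f.scale f.add z(2) algebra_simps)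
      qed
      moreover have "f (g e) = w e" if "e \<in> E" for e
        using that a' by (simp add: gg ff f.scale)
      moreover fix e assume "e \<in> E \<union> w ` E"
      ultimately show "w e = f (g e)" by auto
    qed
    then show "w = f \<circ> g" by auto
  qed
qed

section \<open>Many independent pairs for a map without dominant eigenvalue\<close>

lemma independent_pair_mod:
  assumes z: "z \<notin> span M" and x: "x \<notin> span (insert z M)"
    and eq: "scale a x + scale b z \<in> span M"
  shows "a = 0 \<and> b = 0"
proof -
  have a: "a = 0"
  proof (rule ccontr)
    assume a: "a \<noteq> 0"
    have "scale (1 / a) (scale a x + scale b z) \<in> span M"
      using eq by (rule span_scale)
    then have "x - scale (- b / a) z \<in> span M"
      using a by (simp add: scale_right_distrib)
    then show False using x span_breakdown_eq by blast
  qed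
  have "b = 0"
  proof (rule ccontr)
    assume b: "b \<noteq> 0"
    have "scale (1 / b) (scale a x + scale b z) \<in> span M"
      using eq by (rule span_scale)
    then show False using z a b by simp
  qed
  with a show ?thesis by simp
qed

text \<open>\<open>nodom\<close> is the absence of dominant eigenvalues stated through bases.
  Disjointness is required separately because independence of a union of sets does not exclude that
  they overlap.\<close>

lemma ex_large_independent_pairs:
  assumes u: "lin u" "inj u" and B: "independent B" "span B = UNIV" "infinite B"
    and nodom: "\<And>c M. independent M \<Longrightarrow> range (\<lambda>x. u x - scale c x) \<subseteq> span M \<Longrightarrow> \<not> |M| <o |B|"
  obtains H where "H \<inter> u ` H = {}" "independent (H \<union> u ` H)" "|B| \<le>o |H|"
proof -
  interpret u: Vector_Spaces.linear scale scale u by fact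
  let ?A = "{S. S \<inter> u ` S = {} \<and> independent (S \<union> u ` S)}"
  have "\<exists>H\<in>?A. \<forall>X\<in>?A. H \<subseteq> X \<longrightarrow> X = H"
  proof (rule subset_Zorn')
    fix C assume "subset.chain ?A C"
    then have CA: "C \<subseteq> ?A" and C3: "\<And>S T. S \<in> C \<Longrightarrow> T \<in> C \<Longrightarrow> S \<subseteq> T \<or> T \<subseteq> S"
      unfolding subset_chain_def by simp_all
    have C: "S \<inter> u ` S = {}" "independent (S \<union> u ` S)" if "S \<in> C" for S
      using subsetD[OF CA that] by simp_all
    have U: "\<Union>C \<union> u ` \<Union>C = \<Union>((\<lambda>S. S \<union> u ` S) ` C)"
      by (simp add: image_Union UN_Un_distrib)
    have "independent (\<Union>((\<lambda>S. S \<union> u ` S) ` C))"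
    proof (rule independent_Union_directed)
      fix c d assume "c \<in> (\<lambda>S. S \<union> u ` S) ` C" "d \<in> (\<lambda>S. S \<union> u ` S) ` C"
      then obtain S T where "S \<in> C" "T \<in> C" and cd: "c = S \<union> u ` S" "d = T \<union> u ` T"
        by (elim imageE)
      then consider "S \<subseteq> T" | "T \<subseteq> S" using C3 by metis
      then show "c \<subseteq> d \<or> d \<subseteq> c"
        unfolding cd by cases (simp_all add: Un_mono image_mono le_supI1 le_supI2)
    next
      fix c assume "c \<in> (\<lambda>S. S \<union> u ` S) ` C"
      then show "independent c" using C(2) by (elim imageE) simp
    qed
    moreover have "x \<noteq> u y" if st: "S \<in> C" "T \<in> C" "x \<in> S" "y \<in> T" for S T x y
    proof -
      obtain W where "W \<in> C" "x \<in> W" "y \<in> W"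
        using C3[OF st(1,2)] st by (metis subsetD)
      then show ?thesis using C(1)[of W] by (metis IntI imageI empty_iff)
    qed
    then have "\<Union>C \<inter> u ` \<Union>C = {}"
      by (auto elim!: UnionE)
    ultimately show "\<Union>C \<in> ?A" unfolding U[symmetric] by (intro CollectI conjI)
  qed
  then obtain H where H: "H \<inter> u ` H = {}" "independent (H \<union> u ` H)"
    and max: "\<And>X. X \<inter> u ` X = {} \<Longrightarrow> independent (X \<union> u ` X) \<Longrightarrow> H \<subseteq> X \<Longrightarrow> X = H"
    by (elim bexE CollectE conjE) simp
  have "|B| \<le>o |H|"
  proof (rule ccontr)
    assume "\<not> |B| \<le>o |H|"
    then have HB: "|H| <o |B|"
      by (rule not_ordLeq_iff_ordLess[OF card_of_Well_order card_of_Well_order, THEN iffD1])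
    define M where "M = H \<union> u ` H"
    have M: "independent M" using H by (simp add: M_def)
    have MB: "|M| <o |B|"
      unfolding M_def
      by (rule card_of_Un_ordLess_infinite[OF B(3) HB ordLeq_ordLess_trans[OF card_of_image HB]])
    \<comment> \<open>Fewer than \<open>|B|\<close> independent vectors cannot span, so some
      \<open>z0\<close> and \<open>z1\<close> are independent modulo \<open>span M\<close>.\<close>
    have small: "\<exists>z. z \<notin> span N" if N: "independent N" "|N| <o |B|" for N
    proof (rule ccontr)
      assume "\<not> ?thesis"
      then have sN: "span N = span B" unfolding B(2) by auto
      obtain h where "bij_betw h N B"
        using bij_if_span_eq_span_bases[OF N(1) B(1) sN] by (elim exE)
      then have "|N| =o |B|" by (rule card_of_ordIsoI)
      with N(2) show False by (rule not_ordLess_ordIso[THEN notE])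
    qed
    obtain z0 where z0: "z0 \<notin> span M"
      using small[OF M MB] by (elim exE)
    have "|insert z0 M| <o |B|"
      unfolding insert_is_Un[of z0 M]
      by (rule card_of_Un_ordLess_infinite[OF B(3) finite_less_infinite[OF _ B(3)] MB]) simp
    from small[OF independent_insertI[OF z0 M] this]
    obtain z1 where z1: "z1 \<notin> span (insert z0 M)" ..
    have z1': "z1 \<notin> span M"
      using z1 span_mono[of M "insert z0 M"] by auto
    \<comment> \<open>Otherwise \<open>z\<close> could be added to \<open>H\<close>, against
      maximality.\<close>
    have eig: "\<exists>c. u z - scale c z \<in> span M" if z: "z \<notin> span M" for z
    proof (rule ccontr)
      assume "\<not> ?thesis"
      then have uz: "u z \<notin> span (insert z M)"
        by (auto simp: span_breakdown_eq)
      have "independent (insert (u z) (insert z M))"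
        using uz z M by (simp add: independent_insertI)
      then have 1: "independent (insert z H \<union> u ` insert z H)"
        by (simp add: M_def insert_commute)
      have "u z \<noteq> z" "u z \<notin> H" "z \<notin> u ` H"
        using uz z span_superset[of "insert z M"] span_superset[of M] by (auto simp: M_def)
      then have "insert z H \<inter> u ` insert z H = {}"
        using H(1) by auto
      then have "insert z H = H" using max[OF _ 1] by blast
      then show False using z span_superset[of M] by (auto simp: M_def)
    qed
    \<comment> \<open>Comparing the relations for \<open>z\<close> and \<open>z + m\<close> puts
      \<open>u m\<close> into the line of \<open>z\<close> modulo \<open>span M\<close>; the lines
      of \<open>z0\<close> and \<open>z1\<close> have only zero in common there.\<close>
    have uM: "u m \<in> span M" if m: "m \<in> span M" for m
    proof -
      have *: "\<exists>c. u m - scale c z \<in> span M" if z: "z \<notin> span M" for z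
      proof -
        obtain c where c: "u z - scale c z \<in> span M" using eig[OF z] ..
        have "z + m \<notin> span M" using z m by (metis add_diff_cancel_right' span_diff)
        from eig[OF this] obtain c' where c': "u (z + m) - scale c' (z + m) \<in> span M" ..
        have "(u (z + m) - scale c' (z + m)) - (u z - scale c z) + scale c' m \<in> span M"
          by (rule span_add[OF span_diff[OF c' c] span_scale[OF m]])
        then have "u m - scale (c' - c) z \<in> span M"
          by (simp add: u.add algebra_simps)
        then show ?thesis ..
      qed
      obtain c where c: "u m - scale c z0 \<in> span M" using *[OF z0] ..
      obtain c' where c': "u m - scale c' z1 \<in> span M" using *[OF z1'] ..
      have "scale c' z1 + scale (- c) z0 \<in> span M"
        using span_diff[OF c c'] by simp
      then have "c' = 0"
        using independent_pair_mod[OF z0 z1] by blast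
      then show ?thesis using c' by simp
    qed
    obtain c where c: "u z0 - scale c z0 \<in> span M" using eig[OF z0] ..
    \<comment> \<open>The eigenvalue at \<open>z0\<close> serves everywhere: by linearity on the
      span of \<open>z0\<close> and \<open>M\<close>, and elsewhere by comparing the relations for
      \<open>x\<close>, \<open>z0\<close> and \<open>x + z0\<close>.\<close>
    have "u x - scale c x \<in> span M" for x
    proof (cases "x \<in> span (insert z0 M)")
      case True
      then obtain k where k: "x - scale k z0 \<in> span M" by (auto simp: span_breakdown_eq)
      have "u (x - scale k z0) - scale c (x - scale k z0) + scale k (u z0 - scale c z0) \<in> span M"
        by (rule span_add[OF span_diff[OF uM[OF k] span_scale[OF k]] span_scale[OF c]])
      then show ?thesis by (simp add: u.add u.diff u.scale algebra_simps)
    next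
      case False
      then have x: "x \<notin> span M" "x + z0 \<notin> span M"
        using independent_pair_mod[OF z0 False, of 1 0] independent_pair_mod[OF z0 False, of 1 1] by auto
      obtain c1 where c1: "u x - scale c1 x \<in> span M" using eig[OF x(1)] ..
      obtain c2 where c2: "u (x + z0) - scale c2 (x + z0) \<in> span M" using eig[OF x(2)] ..
      have "(u x - scale c1 x) + (u z0 - scale c z0) - (u (x + z0) - scale c2 (x + z0)) \<in> span M"
        by (rule span_diff[OF span_add[OF c1 c] c2])
      then have 0: "scale (c2 - c1) x + scale (c2 - c) z0 \<in> span M"
        by (simp add: u.add algebra_simps)
      then have "c2 = c1" "c2 = c"
        using independent_pair_mod[OF z0 False 0] by auto
      then show ?thesis using c1 by simp
    qed
    then show False using nodom[OF M, of c] MB by blast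
  qed
  with H show thesis using that by blast
qed


section \<open>Freeness over the Laurent polynomials in \<open>w\<close>\<close>

lemma independentI_dual:
  assumes "\<And>x. x \<in> B \<Longrightarrow> \<exists>k. (\<forall>x y. k (x + y) = k x + k y) \<and> (\<forall>c x. k (scale c x) = c * k x)
      \<and> k x \<noteq> 0 \<and> (\<forall>y\<in>B - {x}. k y = 0)"
  shows "independent B"
proof
  assume "dependent B"
  then obtain x where x: "x \<in> B" "x \<in> span (B - {x})"
    by (auto simp: dependent_def)
  obtain k where k: "\<forall>x y. k (x + y) = k x + k y" "\<forall>c x. k (scale c x) = c * k x"
      "k x \<noteq> 0" "\<forall>y\<in>B - {x}. k y = 0"
    using assms[OF x(1)] by blast
  have "k 0 = 0" using k(2)[rule_format, of 0 0] by simp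
  then have "subspace {y. k y = 0}"
    using k(1,2) by (intro subspaceI) auto
  then have "span (B - {x}) \<subseteq> {y. k y = 0}"
    using k(4) by (intro span_minimal) blast+
  then show False using x(2) k(3) by blast
qed

text \<open>As \<open>b\<close> runs over \<open>B\<close>, the argument of \<open>w\<close> on the
  left of \<open>wc\<close> runs over the basis vectors outside \<open>H\<close>. Applying the
  inverse of \<open>w\<close> to \<open>wc\<close> eliminates every \<open>\<sigma> b\<close>, so
  the vectors of \<open>B\<close> that are no \<open>\<sigma> b\<close> are free generators. Since 1
  and \<open>w\<close> form a basis of the Laurent polynomials over the polynomials in
  \<open>s = w + d w^-1\<close>, the powers of \<open>s\<close> applied to the generators form
  \<open>E\<close>.\<close>

lemma ex_shift_basis:
  assumes w: "lin w" "bij w" and d: "d \<noteq> 0"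
    and HB: "H \<subseteq> B" and ind: "independent (B \<union> w ` H)" and disj: "B \<inter> w ` H = {}"
    and sp: "span (B \<union> w ` H) = UNIV"
    and wc: "\<And>b. b \<in> B \<Longrightarrow> w (if b \<in> H then w b else b) = e b + w (\<sigma> b)"
    and e: "\<And>b. b \<in> B \<Longrightarrow> e b \<in> span (T b) \<and> T b \<subseteq> B"
    and wf: "wf R" and R: "\<And>b. b \<in> B \<Longrightarrow> (b, \<sigma> b) \<in> R"
      "\<And>b t. b \<in> B \<Longrightarrow> t \<in> T b \<Longrightarrow> (t, \<sigma> b) \<in> R"
    and \<sigma>: "inj_on \<sigma> B" "\<sigma> ` B \<subseteq> H"
  obtains E z where "independent (E \<union> w ` E)" "E \<inter> w ` E = {}"
      "span (E \<union> w ` E) = UNIV"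
      "\<And>x. x \<in> E \<Longrightarrow> z x \<in> span E"
      "\<And>x. x \<in> E \<Longrightarrow> w (w x) = w (z x) - scale d x"
proof -
  interpret w: Vector_Spaces.linear scale scale w by fact
  define v where "v = inv w"
  have wv[simp]: "w (v x) = x" and vw[simp]: "v (w x) = x" for x
    using w(2) by (simp_all add: v_def bij_is_surj surj_f_inv_f bij_is_inj)
  have "lin v"
    by (rule linI) (metis wv vw w.add, metis wv vw w.scale)
  then interpret v: Vector_Spaces.linear scale scale v .
  define s where "s x = w x + scale d (v x)" for x
  have ws: "w (s x) = w (w x) + scale d x" for x
    by (simp add: s_def w.add w.scale)
  define E where "E = {(s ^^ n) \<xi> | n \<xi>. \<xi> \<in> B - \<sigma> ` B}"
  have E: "(s ^^ n) \<xi> \<in> E" if "\<xi> \<in> B" "\<xi> \<notin> \<sigma> ` B" for n \<xi>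
    using that by (auto simp: E_def)
  have sE: "s x \<in> E" if x: "x \<in> E" for x
  proof -
    from x obtain n \<xi> where *: "\<xi> \<in> B" "\<xi> \<notin> \<sigma> ` B" and "x = (s ^^ n) \<xi>"
      by (auto simp: E_def)
    then show ?thesis using E[OF *, of "Suc n"] by simp
  qed
  let ?S = "span (E \<union> w ` E)"
  \<comment> \<open>The span is stable under \<open>w\<close> and its inverse because
    \<open>w^2 = s w - d\<close> and \<open>w^-1 = (s - w) / d\<close>.\<close>
  have wS: "w x \<in> ?S" if "x \<in> ?S" for x
  proof -
    have "w ` (E \<union> w ` E) \<subseteq> ?S"
    proof safe
      fix x assume x: "x \<in> E"
      show "w x \<in> ?S" using x by (intro span_base) simp
      have "w (s x) - scale d x \<in> ?S"
        using x sE[OF x] by (intro span_diff span_scale span_base) simp_all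
      then show "w (w x) \<in> ?S" by (simp add: ws)
    qed
    then have "span (w ` (E \<union> w ` E)) \<subseteq> ?S" by (intro span_minimal) auto
    then show ?thesis using that by (auto simp: w.span_image)
  qed
  have vS: "v x \<in> ?S" if "x \<in> ?S" for x
  proof -
    have "v ` (E \<union> w ` E) \<subseteq> ?S"
    proof safe
      fix x assume x: "x \<in> E"
      show "v (w x) \<in> ?S" using x by (simp add: span_base)
      have "scale (1 / d) (s x - w x) \<in> ?S"
        using x sE[OF x] by (intro span_diff span_scale span_base) simp_all
      then show "v x \<in> ?S" using d by (simp add: s_def)
    qed
    then have "span (v ` (E \<union> w ` E)) \<subseteq> ?S" by (intro span_minimal) auto
    then show ?thesis using that by (auto simp: v.span_image)
  qed
  \<comment> \<open>A generator is in \<open>E\<close> with exponent 0; any other vector is some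
    \<open>\<sigma> b'\<close>, which \<open>wc\<close> expresses through \<open>b'\<close> and
    \<open>T b'\<close>, both below it.\<close>
  have BS: "b \<in> B \<longrightarrow> b \<in> ?S" for b
    using wf
  proof (induction b)
    case (less b)
    show ?case
    proof
      assume b: "b \<in> B"
      show "b \<in> ?S"
      proof (cases "b \<in> \<sigma> ` B")
        case False
        then show ?thesis using E[OF b False, of 0] by (intro span_base) simp
      next
        case True
        then obtain b' where b': "b' \<in> B" "b = \<sigma> b'" by blast
        have "b' \<in> ?S" using less[of b'] b' R(1) by blast
        then have c: "(if b' \<in> H then w b' else b') \<in> ?S" using wS by simp
        have "T b' \<subseteq> ?S" using less b' R(2) e by blast
        then have "e b' \<in> ?S" using e[OF b'(1)] span_minimal[of "T b'" ?S] by blast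
        then have "v (w (if b' \<in> H then w b' else b') - e b') \<in> ?S"
          using c by (intro vS span_diff wS)
        then show ?thesis unfolding wc[OF b'(1)] by (simp add: b'(2))
      qed
    qed
  qed
  have span: "?S = UNIV"
  proof -
    have "B \<union> w ` H \<subseteq> ?S" using BS wS HB by blast
    then show ?thesis using span_minimal[of "B \<union> w ` H" ?S] sp by auto
  qed

  txt \<open>Independence is tested in the free module of rank one over the Laurent polynomials in \<open>w\<close>: with
    the basis \<open>1, w\<close> over the polynomials in \<open>s\<close> it consists of pairs of polynomials, on which \<open>w\<close>
    acts by \<open>W\<close> and \<open>w\<^sup>-\<^sup>1\<close> by \<open>V\<close>. The map \<open>\<Theta>\<close> reads off the component of the generator \<open>\<xi>\<close>.\<close>
  define sc :: "'a \<Rightarrow> 'a poly \<times> 'a poly \<Rightarrow> 'a poly \<times> 'a poly"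
    where "sc c x = (smult c (fst x), smult c (snd x))" for c x
  define W :: "'a poly \<times> 'a poly \<Rightarrow> 'a poly \<times> 'a poly"
    where "W x = (- smult d (snd x), fst x + pCons 0 (snd x))" for x
  define V :: "'a poly \<times> 'a poly \<Rightarrow> 'a poly \<times> 'a poly"
    where "V x = (snd x + smult (1 / d) (pCons 0 (fst x)), - smult (1 / d) (fst x))" for x
  have WV: "W (V x) = x" and VW: "V (W x) = x" for x
    using d by (auto simp: W_def V_def prod_eq_iff)
  have Wadd: "W (x + y) = W x + W y" and Wsc: "W (sc c x) = sc c (W x)" for x y c
    by (auto simp: W_def sc_def smult_add_right mult.commute)
  have "vector_space sc"
    by unfold_locales (auto simp: sc_def smult_add_right smult_add_left prod_eq_iff)
  then interpret sc: vector_space sc .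
  interpret p: vector_space_pair scale sc ..
  have indB: "independent B" using ind independent_mono by blast
  have ex: "\<exists>\<Theta>. Vector_Spaces.linear scale sc \<Theta> \<and> (\<forall>x. \<Theta> (w x) = W (\<Theta> x)) \<and>
      (\<forall>b\<in>B - \<sigma> ` B. \<Theta> b = (if b = \<xi> then (1, 0) else 0))" for \<xi>
  proof -
    \<comment> \<open>The recursion for \<open>\<Theta>\<close> on \<open>B\<close>: generators go
      to the unit \<open>(1, 0)\<close> or to 0, and the value at \<open>\<sigma> b'\<close> is
      forced by \<open>wc\<close>.\<close>
    define F where "F f b = (if b \<in> \<sigma> ` B then let b' = the_inv_into B \<sigma> b in
        (if b' \<in> H then W (f b') else f b') - V (p.construct B f (e b'))
      else if b = \<xi> then (1, 0) else 0)" for f b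
    define \<theta> where "\<theta> = wfrec R F"
    \<comment> \<open>As \<open>e b'\<close> lies in the span of \<open>T b'\<close>, the linear
      extension of \<open>f\<close> is evaluated there using only values below
      \<open>\<sigma> b'\<close>.\<close>
    have "adm_wf R F"
      unfolding adm_wf_def
    proof (intro allI impI)
      fix f g :: "'b \<Rightarrow> 'a poly \<times> 'a poly" and b
      assume fg: "\<forall>z. (z, b) \<in> R \<longrightarrow> f z = g z"
      show "F f b = F g b"
      proof (cases "b \<in> \<sigma> ` B")
        case True
        then obtain b' where b': "b' \<in> B" "b = \<sigma> b'" by blast
        have "p.construct B f (e b') = p.construct B g (e b')"
        proof (rule p.linear_eq_on[OF p.linear_construct p.linear_construct])
          show "e b' \<in> span (T b')" using e b' by blast
          fix t assume t: "t \<in> T b'"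
          then have "t \<in> B" "f t = g t"
            using e[OF b'(1)] R(2)[OF b'(1) t] fg b'(2) by auto
          then show "p.construct B f t = p.construct B g t"
            by (simp add: p.construct_basis[OF indB])
        qed (fact indB)+
        moreover have "f b' = g b'" using fg b' R(1) by blast
        ultimately show ?thesis
          using b' by (simp add: F_def the_inv_into_f_f[OF \<sigma>(1)])
      qed (simp add: F_def)
    qed
    then have \<theta>: "\<theta> b = F \<theta> b" for b
      using wfrec_def_adm[of \<theta> R F] wf by (simp add: \<theta>_def)
    define \<Theta> where "\<Theta> = p.construct (B \<union> w ` H) (\<lambda>x. if x \<in> B then \<theta> x else W (\<theta> (v x)))"
    have l: "Vector_Spaces.linear scale sc \<Theta>"
      unfolding \<Theta>_def by (rule p.linear_construct[OF ind])
    interpret t: Vector_Spaces.linear scale sc \<Theta> by (fact l)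
    have tB: "\<Theta> b = \<theta> b" if "b \<in> B" for b
      using that by (simp add: \<Theta>_def p.construct_basis[OF ind])
    have tH: "\<Theta> (w h) = W (\<theta> h)" if "h \<in> H" for h
      using that disj by (auto simp: \<Theta>_def p.construct_basis[OF ind])
    have te: "\<Theta> x = p.construct B \<theta> x" if "x \<in> span B" for x
      by (rule p.linear_eq_on[OF l p.linear_construct[OF indB] that])
        (simp add: tB p.construct_basis[OF indB])
    have Fs: "\<theta> (\<sigma> b) = (if b \<in> H then W (\<theta> b) else \<theta> b) - V (p.construct B \<theta> (e b))" if "b \<in> B" for b
      using that by (subst \<theta>) (simp add: F_def the_inv_into_f_f[OF \<sigma>(1)])
    \<comment> \<open>Commutation with \<open>w\<close> holds on \<open>H\<close> by the definition
      of \<open>\<Theta>\<close>; on the other basis vectors it is the relation encoded in the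
      recursion.\<close>
    have c: "\<Theta> (w (if b \<in> H then w b else b)) = W (if b \<in> H then W (\<theta> b) else \<theta> b)" if b: "b \<in> B" for b
    proof -
      have "e b \<in> span B" using e[OF b] span_mono[of "T b" B] by blast
      moreover have "\<sigma> b \<in> H" using \<sigma>(2) b by blast
      moreover have "(if b \<in> H then W (\<theta> b) else \<theta> b) = \<theta> (\<sigma> b) + V (p.construct B \<theta> (e b))"
        using Fs[OF b] by simp
      ultimately show ?thesis
        by (simp only: wc[OF b] t.add te tH Wadd WV add.commute)
    qed
    have "\<Theta> (w x) = W (\<Theta> x)" for x
    proof (rule p.linear_eq_on[where B = "B \<union> w ` H"])
      show "Vector_Spaces.linear scale sc (\<lambda>x. \<Theta> (w x))" "Vector_Spaces.linear scale sc (\<lambda>x. W (\<Theta> x))"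
        by (simp_all add: Vector_Spaces.linear_iff vector_space_axioms sc.vector_space_axioms
            w.add w.scale t.add t.scale Wadd Wsc)
      show "x \<in> span (B \<union> w ` H)" by (simp add: sp)
      fix b assume "b \<in> B \<union> w ` H"
      then consider "b \<in> B" "b \<notin> H" | "b \<in> H" | h where "h \<in> H" "b = w h" by blast
      then show "\<Theta> (w b) = W (\<Theta> b)"
      proof cases
        case 1 then show ?thesis using c[of b] by (simp add: tB)
      next
        case 2 then show ?thesis using HB by (auto simp: tB tH)
      next
        case 3 then show ?thesis using c[of h] HB by (auto simp: tH)
      qed
    qed
    moreover have "\<forall>b\<in>B - \<sigma> ` B. \<Theta> b = (if b = \<xi> then (1, 0) else 0)"
    proof
      fix b assume b: "b \<in> B - \<sigma> ` B"
      have "\<theta> b = (if b = \<xi> then (1, 0) else 0)"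
        using b by (subst \<theta>) (simp add: F_def)
      then show "\<Theta> b = (if b = \<xi> then (1, 0) else 0)"
        using b by (simp add: tB)
    qed
    ultimately show ?thesis using l by blast
  qed
  obtain \<Theta> where l: "\<And>\<xi>. Vector_Spaces.linear scale sc (\<Theta> \<xi>)"
    and tw: "\<And>\<xi> x. \<Theta> \<xi> (w x) = W (\<Theta> \<xi> x)"
    and tb: "\<And>\<xi> b. b \<in> B \<Longrightarrow> b \<notin> \<sigma> ` B \<Longrightarrow> \<Theta> \<xi> b = (if b = \<xi> then (1, 0) else 0)"
    using ex by (metis DiffI)
  have tadd: "\<Theta> \<xi> (x + y) = \<Theta> \<xi> x + \<Theta> \<xi> y" and tsc: "\<Theta> \<xi> (scale c x) = sc c (\<Theta> \<xi> x)" for \<xi> x y c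
    using l[of \<xi>] by (simp_all add: Vector_Spaces.linear_iff)
  have tv: "\<Theta> \<xi> (v x) = V (\<Theta> \<xi> x)" for \<xi> x
    using tw[of \<xi> "v x"] by (simp add: VW)
  \<comment> \<open>In \<open>W + d V\<close> the mixed terms cancel, which leaves multiplication by
    the variable.\<close>
  have ts: "\<Theta> \<xi> (s x) = (pCons 0 (fst (\<Theta> \<xi> x)), pCons 0 (snd (\<Theta> \<xi> x)))" for \<xi> x
    using d by (simp add: s_def tadd tsc tw tv sc_def W_def V_def smult_add_right)
  have tE: "\<Theta> \<xi> ((s ^^ n) \<eta>) = (if \<eta> = \<xi> then (monom 1 n, 0) else 0)" if "\<eta> \<in> B" "\<eta> \<notin> \<sigma> ` B" for \<xi> \<eta> n
  proof (induction n)
    case 0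
    then show ?case using tb[OF that] by simp
  next
    case (Suc n)
    then show ?case by (simp add: ts monom_Suc zero_prod_def)
  qed
  have tE': "\<Theta> \<xi> (w ((s ^^ n) \<eta>)) = (if \<eta> = \<xi> then (0, monom 1 n) else 0)" if "\<eta> \<in> B" "\<eta> \<notin> \<sigma> ` B" for \<xi> \<eta> n
    by (simp add: tw tE[OF that] W_def zero_prod_def)
  have disjE: "E \<inter> w ` E = {}"
  proof (safe, goal_cases)
    case (1 _ x)
    then obtain n \<xi> m \<eta> where *: "\<xi> \<in> B" "\<xi> \<notin> \<sigma> ` B" "\<eta> \<in> B" "\<eta> \<notin> \<sigma> ` B"
      and "w x = (s ^^ n) \<xi>" "x = (s ^^ m) \<eta>"
      unfolding E_def by blast
    then have "(s ^^ n) \<xi> = w ((s ^^ m) \<eta>)" by simp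
    then have "\<Theta> \<xi> ((s ^^ n) \<xi>) = \<Theta> \<xi> (w ((s ^^ m) \<eta>))" by simp
    then show ?case by (simp add: tE[OF *(1,2)] tE'[OF *(3,4)] zero_prod_def split: if_splits)
  qed
  have indE: "independent (E \<union> w ` E)"
  proof (rule independentI_dual)
    fix x assume "x \<in> E \<union> w ` E"
    then obtain n \<xi> where \<xi>: "\<xi> \<in> B" "\<xi> \<notin> \<sigma> ` B" and x: "x = (s ^^ n) \<xi> \<or> x = w ((s ^^ n) \<xi>)"
      unfolding E_def by blast
    have Ec: "\<exists>m \<eta>. \<eta> \<in> B \<and> \<eta> \<notin> \<sigma> ` B \<and> (y = (s ^^ m) \<eta> \<or> y = w ((s ^^ m) \<eta>))" if "y \<in> E \<union> w ` E" for y
      using that unfolding E_def by blast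
    let ?Q = "\<lambda>k. (\<forall>x y. k (x + y) = k x + k y) \<and> (\<forall>c x. k (scale c x) = c * k x)
      \<and> k x \<noteq> 0 \<and> (\<forall>y\<in>E \<union> w ` E - {x}. k y = 0)"
    \<comment> \<open>The dual functional is the coefficient of degree \<open>n\<close> in the first
      or second component of \<open>\<Theta> \<xi>\<close>.\<close>
    from x show "\<exists>k. ?Q k"
    proof
      assume x: "x = (s ^^ n) \<xi>"
      have "coeff (fst (\<Theta> \<xi> y)) n = 0" if "y \<in> E \<union> w ` E - {x}" for y
        using Ec[of y] that x by (auto simp: tE tE')
      then have "?Q (\<lambda>y. coeff (fst (\<Theta> \<xi> y)) n)"
        by (simp add: tadd tsc sc_def x tE[OF \<xi>])
      then show ?thesis by (rule exI[of ?Q])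
    next
      assume x: "x = w ((s ^^ n) \<xi>)"
      have "coeff (snd (\<Theta> \<xi> y)) n = 0" if "y \<in> E \<union> w ` E - {x}" for y
        using Ec[of y] that x by (auto simp: tE tE')
      then have "?Q (\<lambda>y. coeff (snd (\<Theta> \<xi> y)) n)"
        by (simp add: tadd tsc sc_def x tE'[OF \<xi>])
      then show ?thesis by (rule exI[of ?Q])
    qed
  qed
  show thesis
  proof (rule that[OF indE disjE span])
    fix x assume "x \<in> E"
    then show "s x \<in> span E" using sE by (intro span_base)
    show "w (w x) = w (s x) - scale d x" by (simp add: ws)
  qed
qed

section \<open>Construction of \<open>w\<close> and of the first factor\<close>

lemma ex_three_quadratic_factors:
  assumes u: "lin u" "bij u" and D0: "independent D0" "span D0 = UNIV" "infinite D0"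
    and nodom: "\<And>c M. independent M \<Longrightarrow> range (\<lambda>x. u x - scale c x) \<subseteq> span M \<Longrightarrow> \<not> |M| <o |D0|"
    and \<beta>: "\<beta> \<noteq> 0" and nz: "a \<noteq> 0" "b \<noteq> 0" "a' \<noteq> 0" "b' \<noteq> 0"
  obtains f g h where "quadratic 1 (1 / \<beta>) f" "quadratic a b g" "quadratic a' b' h" "u = f \<circ> g \<circ> h"
proof -
  interpret u: Vector_Spaces.linear scale scale u by fact
  have inju: "inj u" using u(2) by (rule bij_is_inj)
  obtain H where H: "H \<inter> u ` H = {}" "independent (H \<union> u ` H)" "|D0| \<le>o |H|"
    using ex_large_independent_pairs[OF u(1) inju D0 nodom] .
  define D where "D = extend_basis (H \<union> u ` H)"
  have D: "H \<union> u ` H \<subseteq> D" "independent D" "span D = UNIV"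
    unfolding D_def
    by (rule extend_basis_superset[OF H(2)], rule independent_extend_basis[OF H(2)],
        rule span_extend_basis[OF H(2)])
  define B where "B = D - u ` H"
  have HB: "H \<subseteq> B" and BD: "B \<union> u ` H = D" and disj: "B \<inter> u ` H = {}"
    using D(1) H(1) by (auto simp: B_def)
  have uH: "u x \<in> D" "u x \<notin> B" "u x \<notin> H" if "x \<in> H" for x
    using that D(1) H(1) by (auto simp: B_def)
  obtain \<phi> where "bij_betw \<phi> D D0"
    using bij_if_span_eq_span_bases[OF D(2) D0(1)] D(3) D0(2) by auto
  then have "|D| =o |D0|" by (rule card_of_ordIsoI)
  moreover have "|B| \<le>o |D|" by (rule card_of_mono1) (simp add: B_def)
  ultimately have "|B| \<le>o |D0|" using ordLeq_ordIso_trans by metis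
  then have BH: "|B| \<le>o |H|" using H(3) ordLeq_transitive by metis
  have "infinite H" using H(3) D0(3) card_of_ordLeq_infinite by metis
  then have infB: "infinite B" using HB finite_subset by metis
  have indB: "independent B" using D(2) by (rule independent_mono) (simp add: B_def)

  define P where "P = vv.construct D (\<lambda>x. if x \<in> B then x else 0)"
  have lP: "lin P" unfolding P_def by (rule vv.linear_construct[OF D(2)])
  interpret P: Vector_Spaces.linear scale scale P by fact
  have PB: "P x = x" if "x \<in> span B" for x
    by (rule vv.linear_eq_on[OF lP _ that])
      (auto intro!: linI simp: P_def vv.construct_basis[OF D(2)] B_def)
  have PK: "P (u x) = 0" if "x \<in> span H" for x
  proof (rule vv.linear_eq_on[of "\<lambda>x. P (u x)" "\<lambda>x. 0", OF _ vv.linear_zero that])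
    show "lin (\<lambda>x. P (u x))" by (rule linI) (simp_all add: P.add P.scale u.add u.scale)
    fix x assume "x \<in> H"
    then show "P (u x) = 0"
      using uH by (simp add: P_def vv.construct_basis[OF D(2)])
  qed
  have Pin: "P x \<in> span B" for x
  proof -
    have "(\<lambda>x. if x \<in> B then x else 0) ` D \<subseteq> span B"
      by (auto intro: span_base span_zero)
    then have "span ((\<lambda>x. if x \<in> B then x else 0) ` D) \<subseteq> span B"
      by (rule span_minimal) (rule subspace_span)
    then show ?thesis
      using vv.construct_in_span[OF D(2), of "\<lambda>x. if x \<in> B then x else 0" x] by (auto simp: P_def)
  qed
  have kerP: "\<exists>h\<in>span H. x = u h" if "P x = 0" for x
  proof -
    have "x \<in> span (B \<union> u ` H)" by (simp add: BD D(3))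
    then obtain y k where y: "y \<in> span B" and k: "k \<in> span (u ` H)" and x: "x = y + k"
      by (auto simp: span_Un)
    obtain h where h: "h \<in> span H" "k = u h" using k by (auto simp: u.span_image)
    then have "y = 0" using that x by (simp add: P.add PB[OF y] PK)
    with h x show ?thesis by auto
  qed

  define c where "c b = (if b \<in> H then u b else b)" for b
  define e where "e b = scale \<beta> (P (u (c b)))" for b
  define T where "T b = {t. representation B (e b) t \<noteq> 0}" for b
  have eB: "e b \<in> span B" for b unfolding e_def by (intro span_scale Pin)
  have T: "finite (T b)" "T b \<subseteq> B" for b
    using representation_ne_zero[of B "e b"] by (auto simp: T_def finite_representation)
  have eT: "e b \<in> span (T b)" for b
  proof -
    have "(\<Sum>t\<in>T b. scale (representation B (e b) t) t) = e b"
      unfolding T_def by (rule sum_nonzero_representation_eq[OF indB eB])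
    moreover have "(\<Sum>t\<in>T b. scale (representation B (e b) t) t) \<in> span (T b)"
      by (intro span_sum span_scale span_base)
    ultimately show ?thesis by simp
  qed
  \<comment> \<open>\<open>b\<close> is added to the support so that it, too, precedes
    \<open>\<sigma> b\<close>, as the recursion in \<open>ex_shift_basis\<close> requires.\<close>
  obtain \<sigma> R where wf: "wf R" and \<sigma>: "inj_on \<sigma> B" "\<sigma> ` B \<subseteq> H"
    and R: "\<And>b s. b \<in> B \<Longrightarrow> s \<in> insert b (T b) \<Longrightarrow> (s, \<sigma> b) \<in> R"
    by (rule inj_choice_above_finite[OF infB BH HB, of "\<lambda>b. insert b (T b)"]) (use T in auto)

  \<comment> \<open>The part of \<open>w\<close> with values in the kernel of \<open>P\<close>. For
    \<open>x = u h\<close> with \<open>h \<in> H\<close>, \<open>inv u x\<close> recovers the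
    \<open>b\<close> with \<open>c b = x\<close>.\<close>
  define \<tau> where "\<tau> = vv.construct D
    (\<lambda>x. if x \<in> H then u x else u (\<sigma> (if x \<in> B then x else inv u x)))"
  have l\<tau>: "lin \<tau>" unfolding \<tau>_def by (rule vv.linear_construct[OF D(2)])
  interpret t: Vector_Spaces.linear scale scale \<tau> by fact
  have tH: "\<tau> h = u h" if "h \<in> H" for h
    using that D(1) by (auto simp: \<tau>_def vv.construct_basis[OF D(2)])
  have tc: "\<tau> (c b) = u (\<sigma> b)" if b: "b \<in> B" for b
  proof (cases "b \<in> H")
    case True
    then show ?thesis
      using uH by (simp add: \<tau>_def vv.construct_basis[OF D(2)] c_def inv_f_f[OF inju])
  next
    case False
    moreover have "b \<in> D" using b by (simp add: B_def)
    ultimately show ?thesis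
      using b by (simp add: \<tau>_def vv.construct_basis[OF D(2)] c_def)
  qed
  have Pt: "P (\<tau> x) = 0" for x
  proof (rule lin_eqI[of "\<lambda>x. P (\<tau> x)" "\<lambda>x. 0", OF _ vv.linear_zero D(3)])
    show "lin (\<lambda>x. P (\<tau> x))" by (rule linI) (simp_all add: P.add P.scale t.add t.scale)
    fix x assume x: "x \<in> D"
    consider "x \<in> H" | "x \<in> B" "x \<notin> H" | h where "h \<in> H" "x = u h"
      using x BD by blast
    then show "P (\<tau> x) = 0"
    proof cases
      case 1
      then show ?thesis by (simp add: tH PK span_base)
    next
      case 2
      then have "\<tau> x = u (\<sigma> x)" "\<sigma> x \<in> H" using tc[of x] \<sigma>(2) by (auto simp: c_def)
      then show ?thesis by (simp add: PK span_base)
    next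
      case 3
      then have "\<tau> x = u (\<sigma> h)" "\<sigma> h \<in> H" using tc[of h] \<sigma>(2) HB by (auto simp: c_def)
      then show ?thesis by (simp add: PK span_base)
    qed
  qed

  define w where "w x = scale \<beta> (P (u x)) + \<tau> x" for x
  have lw: "lin w"
    by (rule linI) (simp_all add: w_def P.add P.scale t.add t.scale u.add u.scale
        scale_right_distrib mult.commute)
  interpret w: Vector_Spaces.linear scale scale w by fact
  have wH: "w h = u h" if "h \<in> span H" for h
    by (rule vv.linear_eq_on[OF lw u(1) that]) (simp add: w_def PK span_base tH)
  have Pw: "P (w x) = scale \<beta> (P (u x))" for x
    by (simp add: w_def P.add P.scale Pt PB[OF Pin])
  have imw: "w ` H = u ` H"
    by (rule image_cong) (simp_all add: wH span_base)
  \<comment> \<open>\<open>w x = 0\<close> gives \<open>P (u x) = 0\<close>, which puts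
    \<open>x\<close> into \<open>span H\<close>, where \<open>w\<close> agrees with the injective
    \<open>u\<close>.\<close>
  have "inj w"
    unfolding w.inj_iff_eq_0
  proof (intro allI impI)
    fix x assume x: "w x = 0"
    then have "P (u x) = 0" using Pw[of x] \<beta> by simp
    then obtain h where "h \<in> span H" "u x = u h" using kerP by blast
    then have h: "x \<in> span H" using inju by (auto dest: injD)
    then have "u x = u 0" using wH[OF h] x by simp
    then show "x = 0" by (rule injD[OF inju])
  qed
  \<comment> \<open>Surjectivity of \<open>u\<close> matches \<open>P y\<close>; the remaining
    difference lies in the kernel of \<open>P\<close>, the image of \<open>span H\<close> under
    \<open>w\<close>.\<close>
  moreover have "\<exists>x. y = w x" for y
  proof -
    obtain x where x: "u x = scale (1 / \<beta>) (P y)"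
      using bij_is_surj[OF u(2)] by (metis surjD)
    have "P (y - w x) = 0"
      using \<beta> by (simp add: P.diff Pw x P.scale PB[OF Pin])
    then obtain h where "h \<in> span H" "y - w x = u h" using kerP by blast
    then have "y = w (x + h)" by (simp add: w.add wH algebra_simps)
    then show ?thesis ..
  qed
  ultimately have bw: "bij w" unfolding bij_def surj_def by blast

  define v where "v = inv w"
  have wv[simp]: "w (v x) = x" and vw[simp]: "v (w x) = x" for x
    using bw by (simp_all add: v_def bij_is_surj surj_f_inv_f bij_is_inj)
  have vadd: "v (x + y) = v x + v y" and vscale: "v (scale r x) = scale r (v x)" for x y r
    by (metis wv vw w.add, metis wv vw w.scale)
  define f where "f x = u (v x)" for x
  have "lin f"
    by (rule linI) (simp_all add: f_def vadd vscale u.add u.scale)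
  then interpret f: Vector_Spaces.linear scale scale f .
  \<comment> \<open>\<open>f\<close> is the identity on the kernel of \<open>P\<close>, and
    \<open>f y - y / \<beta>\<close> lies in that kernel.\<close>
  have "f (f y) = scale (1 + 1 / \<beta>) (f y) - scale (1 * (1 / \<beta>)) y" for y
  proof -
    have "P (f y - scale (1 / \<beta>) y) = 0"
      using Pw[of "v y"] \<beta> by (simp add: f_def P.diff P.scale)
    then obtain h where h: "h \<in> span H" "f y - scale (1 / \<beta>) y = u h" using kerP by blast
    have "f (u h) = u h"
      using vw[of h] by (simp add: f_def wH[OF h(1)])
    then have "f (f y - scale (1 / \<beta>) y) = f y - scale (1 / \<beta>) y" by (simp add: h(2))
    then have "f (f y) = f y - scale (1 / \<beta>) y + scale (1 / \<beta>) (f y)"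
      by (simp add: f.diff f.scale diff_eq_eq)
    then show ?thesis by (simp add: scale_left_distrib)
  qed
  then have qf: "quadratic 1 (1 / \<beta>) f"
    using \<open>lin f\<close> by (simp add: quadratic_def)

  have wc: "w (if b \<in> H then w b else b) = e b + w (\<sigma> b)" if b: "b \<in> B" for b
  proof -
    have "(if b \<in> H then w b else b) = c b"
      by (simp add: c_def wH span_base)
    moreover have "w (\<sigma> b) = u (\<sigma> b)"
      using \<sigma>(2) b by (intro wH span_base) auto
    ultimately show ?thesis by (simp add: w_def[of "c b"] e_def tc[OF b])
  qed
  have d: "a * b * (a' * b') \<noteq> 0" using nz by simp
  have ind: "independent (B \<union> w ` H)" and disj': "B \<inter> w ` H = {}" and sp: "span (B \<union> w ` H) = UNIV"
    using BD D(2,3) disj by (simp_all add: imw)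
  obtain E z where E: "independent (E \<union> w ` E)" "E \<inter> w ` E = {}" "span (E \<union> w ` E) = UNIV"
      "\<And>x. x \<in> E \<Longrightarrow> z x \<in> span E"
      "\<And>x. x \<in> E \<Longrightarrow> w (w x) = w (z x) - scale (a * b * (a' * b')) x"
    using ex_shift_basis[OF lw bw d HB ind disj' sp wc conjI[OF eT T(2)] wf
        R[OF _ insertI1] R[OF _ insertI2] \<sigma>] by blast
  obtain g h where "quadratic a b g" "quadratic a' b' h" "w = g \<circ> h"
    using ex_two_quadratic_factors[OF lw E(1,2) inj_on_subset[OF bij_is_inj[OF bw] subset_UNIV] E(3-5) nz(3)] .
  moreover have "u = f \<circ> w" by (auto simp: f_def)
  ultimately show thesis using that[OF qf] by (simp add: comp_assoc)
qed

end

section \<open>From ranks and polynomials to bases and roots\<close>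

theorem theorem1p4:
  fixes scale :: "'a::field \<Rightarrow> 'b::ab_group_add \<Rightarrow> 'b"
    and p1 p2 p3 :: "'a poly"
    and u :: "'b \<Rightarrow> 'b"
  assumes "vector_space scale"
    and "\<not> (\<exists>B. finite_dimensional_vector_space scale B)"
    and "split_poly p1" "nonderogatory p1" "degree p1 = 2"
    and "split_poly p2" "nonderogatory p2" "degree p2 = 2"
    and "split_poly p3" "nonderogatory p3" "degree p3 = 2"
    and "Vector_Spaces.linear scale scale u" "bij u"
    and "\<not> (\<exists>c. dominant_eigenvalue scale u c)"
  shows "poly_product scale [p1, p2, p3] u"
proof -
  interpret vspace scale
    using assms(1) by (simp add: vspace_def)
  interpret u: Vector_Spaces.linear scale scale u by fact
  obtain a1 b1 where p1: "a1 \<noteq> 0" "b1 \<noteq> 0" "\<And>f. quadratic a1 b1 f \<Longrightarrow> poly_endo scale p1 f = (\<lambda>_. 0)"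
    using poly_endo_quadratic[OF assms(3-5)] by metis
  obtain a2 b2 where p2: "a2 \<noteq> 0" "b2 \<noteq> 0" "\<And>f. quadratic a2 b2 f \<Longrightarrow> poly_endo scale p2 f = (\<lambda>_. 0)"
    using poly_endo_quadratic[OF assms(6-8)] by metis
  obtain a3 b3 where p3: "a3 \<noteq> 0" "b3 \<noteq> 0" "\<And>f. quadratic a3 b3 f \<Longrightarrow> poly_endo scale p3 f = (\<lambda>_. 0)"
    using poly_endo_quadratic[OF assms(9-11)] by metis
  define D where "D = extend_basis {}"
  have D: "independent D" "span D = UNIV"
    unfolding D_def by (rule independent_extend_basis span_extend_basis, rule independent_empty)+
  have "infinite D"
  proof
    assume "finite D"
    then have "finite_dimensional_vector_space scale D"
      using D by unfold_locales
    with assms(2) show False by blast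
  qed
  \<comment> \<open>Dividing by \<open>a1\<close> turns the roots for the first factor into 1 and
    \<open>b1 / a1\<close>, hence \<open>\<beta> = a1 / b1\<close> below.\<close>
  define u' where "u' x = scale (1 / a1) (u x)" for x
  have l: "lin u'"
    by (rule linI) (simp_all add: u'_def u.add u.scale scale_right_distrib mult.commute)
  have "inj u'"
    using bij_is_inj[OF assms(13)] p1(1) by (auto simp: inj_on_def u'_def)
  moreover have "\<exists>x. y = u' x" for y
  proof -
    obtain x where "u x = scale a1 y"
      using bij_is_surj[OF assms(13)] by (metis surjD)
    then have "y = u' x" using p1(1) by (simp add: u'_def)
    then show ?thesis ..
  qed
  ultimately have bij: "bij u'" unfolding bij_def surj_def by blast
  \<comment> \<open>A basis of the range extends to one of \<open>span M\<close>, which is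
    equipotent with \<open>M\<close>; a small \<open>M\<close> would thus make \<open>a1 * c\<close>
    a dominant eigenvalue of \<open>u\<close>.\<close>
  have nodom: "\<not> |M| <o |D|"
    if M: "independent M" "range (\<lambda>x. u' x - scale c x) \<subseteq> span M" for c M
  proof
    assume MD: "|M| <o |D|"
    let ?f = "\<lambda>x. u x - scale (a1 * c) x"
    have f: "lin ?f"
      by (rule linI) (simp_all add: u.add u.scale algebra_simps)
    have "?f x \<in> span M" for x
    proof -
      have "scale a1 (u' x - scale c x) \<in> span M"
        using M(2) by (intro span_scale) auto
      then show ?thesis using p1(1) by (simp add: u'_def scale_right_diff_distrib)
    qed
    then have fM: "range ?f \<subseteq> span M" by blast
    obtain N where N: "N \<subseteq> range ?f" "independent N" "range ?f \<subseteq> span N"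
      by (rule maximal_independent_subset)
    have "subspace (range ?f)"
      using vv.linear_subspace_image[OF f subspace_UNIV] .
    then have sN: "span N = range ?f"
      using N(1,3) span_minimal by blast
    obtain N' where N': "N \<subseteq> N'" "N' \<subseteq> span M" "independent N'" "span M \<subseteq> span N'"
      using maximal_independent_subset_extend[OF subset_trans[OF N(1) fM] N(2)] .
    have "span N' = span M"
      using N'(4) span_minimal[OF N'(2) subspace_span] by (metis subset_antisym)
    then obtain \<phi> where "bij_betw \<phi> N' M"
      using bij_if_span_eq_span_bases[OF N'(3) M(1)] by blast
    then have "|N'| =o |M|" by (rule card_of_ordIsoI)
    then have "|N| <o |D|"
      using ordLeq_ordLess_trans[OF ordLeq_ordIso_trans[OF card_of_mono1[OF N'(1)]] MD] by blast
    moreover have "crank scale ?f =o |N|"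
      unfolding crank_def by (rule cdim_ordIso[OF assms(1) N(2) sN])
    moreover have "|D| =o cdim scale UNIV"
      by (rule ordIso_symmetric[OF cdim_ordIso[OF assms(1) D]])
    ultimately have "crank scale ?f <o cdim scale UNIV"
      using ordIso_ordLess_trans ordLess_ordIso_trans by metis
    then show False
      using assms(14) by (auto simp: dominant_eigenvalue_def)
  qed
  have "a1 / b1 \<noteq> 0" using p1(1,2) by simp
  from ex_three_quadratic_factors[OF l bij D \<open>infinite D\<close> nodom this p2(1,2) p3(1,2)]
  obtain f g h where f: "quadratic 1 (1 / (a1 / b1)) f" and g: "quadratic a2 b2 g"
      and h: "quadratic a3 b3 h" and u': "u' = f \<circ> g \<circ> h" .
  have f': "quadratic a1 b1 (\<lambda>x. scale a1 (f x))"
    using quadratic_scale[OF f, of a1] p1(1) by simp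
  have "u x = scale a1 (f (g (h x)))" for x
  proof -
    have "f (g (h x)) = scale (1 / a1) (u x)"
      using fun_cong[OF u', of x] by (simp add: u'_def)
    then show ?thesis using p1(1) by simp
  qed
  then have "u = foldr (\<circ>) [\<lambda>x. scale a1 (f x), g, h] id"
    by auto
  moreover have "list_all2 (\<lambda>p a. lin a \<and> poly_endo scale p a = (\<lambda>_. 0)) [p1, p2, p3] [\<lambda>x. scale a1 (f x), g, h]"
    using p1(3)[OF f'] p2(3)[OF g] p3(3)[OF h] f' g h by (simp add: quadratic_def)
  ultimately show ?thesis
    unfolding poly_product_def by blast
qed

end
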